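(* (i) Let $(\mathbb{X},\mathcal{M},\mu)$ be a finite measure space, $(\mathbb{Y},d)$ a metric space with Borel $\sigma$-algebra $\mathcal{B}_{\mathbb{Y}}$, and $G\colon(\mathbb{X},\mathcal{M})\to(\mathbb{Y},\mathcal{B}_{\mathbb{Y}})$ a measurable function. If $\operatorname{dens}(\mathbb{Y})$ is strictly smaller than every real-valued measurable cardinal, then $G$ is strongly measurable. (ii) If a real-valued measurable cardinal exists, then there exist a finite measure space $(\mathbb{X},\mathcal{M},\mu)$, a non-separable Banach space $(\mathbb{Y},\|\cdot\|)$, and a measurable function $G\colon(\mathbb{X},\mathcal{M})\to(\mathbb{Y},\mathcal{B}_{\mathbb{Y}})$ which is not strongly measurable.
   Context: A function $G\colon\mathbb{X}\to\mathbb{Y}$ into a metric space is simple if it is $(\mathcal{M},\mathcal{B}_{\mathbb{Y}})$-measurable and takes only finitely many values. $G$ is strongly measurable (with respect to $\mu$) if it is the $\mu$-almost everywhere pointwise limit of a sequence of simple functions. The density $\operatorname{dens}(\mathbb{Y})$ of a metric space is the smallest cardinality of a dense subset. A cardinal $\kappa$ is real-valued measurable if there exist a set $I$ of cardinality $\kappa$ and a countably additive probability measure $\pi$ defined on every subset of $I$ such that (1) $\pi(\{x\})=0$ for every $x\in I$, and (2) whenever fewer than $\kappa$ subsets of $I$ each have $\pi$-measure zero, their union also has $\pi$-measure zero. The base theory is ZFC. *)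

theory Defs
  imports "HOL-Probability.Probability"
begin

unbundle cardinal_syntax
no_notation elt_set_eq (infix "=o" 50)

section \<open>Cardinals\<close>

text \<open>
  A cardinal is a cardinal order in the sense of \<^term>\<open>Card_order\<close>. The index set and the null
  sets are taken inside the type carrying the order; as \<^term>\<open>Field \<kappa>\<close> itself has cardinality
  \<open>\<kappa>\<close>, this loses nothing.
\<close>

definition real_valued_measurable :: "'k rel \<Rightarrow> bool" where
  "real_valued_measurable \<kappa> \<longleftrightarrow> Card_order \<kappa> \<and>
     (\<exists>(I::'k set) (P::'k measure).
        card_of I =o \<kappa> \<and> prob_space P \<and> space P = I \<and> sets P = Pow I \<and>
        (\<forall>x\<in>I. emeasure P {x} = 0) \<and>
        (\<forall>\<A>. \<A> \<subseteq> Pow I \<and> card_of \<A> <o \<kappa> \<and> (\<forall>A\<in>\<A>. emeasure P A = 0)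
             \<longrightarrow> emeasure P (\<Union>\<A>) = 0))"

definition dense_subset :: "'y metric \<Rightarrow> 'y set \<Rightarrow> bool" where
  "dense_subset m D \<longleftrightarrow> D \<subseteq> mspace m \<and> mtopology_of m closure_of D = mspace m"

definition metric_density :: "'y metric \<Rightarrow> 'y rel" where
  "metric_density m = card_of (SOME D. dense_subset m D \<and>
     (\<forall>E. dense_subset m E \<longrightarrow> card_of D \<le>o card_of E))"

section \<open>Strong measurability\<close>

definition metric_borel :: "'y metric \<Rightarrow> 'y measure" where
  "metric_borel m = sigma (mspace m) {U. openin (mtopology_of m) U}"

definition simple_map :: "'x measure \<Rightarrow> 'y metric \<Rightarrow> ('x \<Rightarrow> 'y) \<Rightarrow> bool" where
  "simple_map M m G \<longleftrightarrow> G \<in> M \<rightarrow>\<^sub>M metric_borel m \<and> finite (G ` space M)"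

definition strongly_measurable :: "'x measure \<Rightarrow> 'y metric \<Rightarrow> ('x \<Rightarrow> 'y) \<Rightarrow> bool" where
  "strongly_measurable M m G \<longleftrightarrow> G \<in> space M \<rightarrow> mspace m \<and>
     (\<exists>S. (\<forall>n. simple_map M m (S n)) \<and>
          (AE x in M. limitin (mtopology_of m) (\<lambda>n. S n x) (G x) sequentially))"

section \<open>Banach spaces on a carrier set\<close>

text \<open>
  An existential quantifier cannot range over types, so Banach spaces whose existence is asserted
  are given by a carrier set with operations rather than by the class \<^class>\<open>banach\<close>.
\<close>

locale real_normed_space_on =
  fixes V :: "'v set"
    and add :: "'v \<Rightarrow> 'v \<Rightarrow> 'v"
    and zero :: 'v
    and scal :: "real \<Rightarrow> 'v \<Rightarrow> 'v"
    and nrm :: "'v \<Rightarrow> real"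
  assumes add_closed: "\<lbrakk>x \<in> V; y \<in> V\<rbrakk> \<Longrightarrow> add x y \<in> V"
    and add_assoc: "\<lbrakk>x \<in> V; y \<in> V; z \<in> V\<rbrakk> \<Longrightarrow> add (add x y) z = add x (add y z)"
    and add_commute: "\<lbrakk>x \<in> V; y \<in> V\<rbrakk> \<Longrightarrow> add x y = add y x"
    and zero_closed: "zero \<in> V"
    and add_zero: "x \<in> V \<Longrightarrow> add x zero = x"
    and add_inverse: "x \<in> V \<Longrightarrow> \<exists>y\<in>V. add x y = zero"
    and scale_closed: "x \<in> V \<Longrightarrow> scal a x \<in> V"
    and scale_add_right: "\<lbrakk>x \<in> V; y \<in> V\<rbrakk> \<Longrightarrow> scal a (add x y) = add (scal a x) (scal a y)"
    and scale_add_left: "x \<in> V \<Longrightarrow> scal (a + b) x = add (scal a x) (scal b x)"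
    and scale_scale: "x \<in> V \<Longrightarrow> scal a (scal b x) = scal (a * b) x"
    and scale_one: "x \<in> V \<Longrightarrow> scal 1 x = x"
    and nrm_eq_zero: "x \<in> V \<Longrightarrow> nrm x = 0 \<longleftrightarrow> x = zero"
    and nrm_scale: "x \<in> V \<Longrightarrow> nrm (scal a x) = \<bar>a\<bar> * nrm x"
    and nrm_triangle: "\<lbrakk>x \<in> V; y \<in> V\<rbrakk> \<Longrightarrow> nrm (add x y) \<le> nrm x + nrm y"

text \<open>
  \<^term>\<open>Metric_space\<close> demands nonnegativity and symmetry on the whole type, hence the value 0 off
  the carrier.
\<close>

definition norm_metric ::
    "'v set \<Rightarrow> ('v \<Rightarrow> 'v \<Rightarrow> 'v) \<Rightarrow> (real \<Rightarrow> 'v \<Rightarrow> 'v) \<Rightarrow> ('v \<Rightarrow> real) \<Rightarrow> 'v metric" where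
  "norm_metric V add scal nrm =
     metric (V, \<lambda>x y. if x \<in> V \<and> y \<in> V then nrm (add x (scal (- 1) y)) else 0)"

locale real_banach_space_on = real_normed_space_on V add zero scal nrm
  for V :: "'v set" and add zero scal nrm +
  assumes complete: "mcomplete_of (norm_metric V add scal nrm)"

section \<open>Basic facts\<close>

lemma metric_density_attained:
  "\<exists>D. dense_subset m D \<and> metric_density m = |D| \<and> (\<forall>E. dense_subset m E \<longrightarrow> |D| \<le>o |E| )"
proof -
  let ?R = "{ |D| | D. dense_subset m D}"
  have "dense_subset m (mspace m)"
    unfolding dense_subset_def by (metis closure_of_topspace order_refl topspace_mtopology_of)
  then have "?R \<noteq> {}" by blast
  moreover have "\<forall>r\<in>?R. Card_order r" using card_of_Card_order by blast
  ultimately obtain r where "r \<in> ?R" "\<forall>r'\<in>?R. r \<le>o r'"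
    using exists_minim_Card_order[of ?R] by blast
  then have "\<exists>D. dense_subset m D \<and> (\<forall>E. dense_subset m E \<longrightarrow> |D| \<le>o |E| )" by blast
  from someI_ex[OF this] show ?thesis unfolding metric_density_def by blast
qed

lemma real_valued_measurable_transfer:
  fixes \<kappa> :: "'k rel" and \<nu> :: "'l rel"
  assumes \<kappa>: "real_valued_measurable \<kappa>" and iso: "\<kappa> =o \<nu>"
  shows "real_valued_measurable \<nu>"
proof -
  obtain I and P :: "'k measure" where I: "|I| =o \<kappa>" and P: "prob_space P" "space P = I"
      "sets P = Pow I" "\<forall>x\<in>I. emeasure P {x} = 0"
      and add: "\<And>\<A>. \<lbrakk>\<A> \<subseteq> Pow I; |\<A>| <o \<kappa>; \<forall>A\<in>\<A>. emeasure P A = 0\<rbrakk> \<Longrightarrow> emeasure P (\<Union>\<A>) = 0"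
    using \<kappa> unfolding real_valued_measurable_def by auto
  have co: "Card_order \<kappa>" using \<kappa> by (simp add: real_valued_measurable_def)
  have co': "Card_order \<nu>" by (rule Card_order_ordIso2[OF co iso])
  have "|I| =o |Field \<nu>|"
    by (rule ordIso_transitive[OF ordIso_transitive[OF I iso]
          ordIso_symmetric[OF card_of_Field_ordIso[OF co']]])
  then obtain f where f: "bij_betw f I (Field \<nu>)" using card_of_ordIso by blast
  let ?J = "Field \<nu>"
  let ?Q = "distr P (count_space ?J) f"
  have meas: "f \<in> P \<rightarrow>\<^sub>M count_space ?J"
    using f P by (auto simp: measurable_def bij_betw_def)
  have em: "emeasure ?Q A = emeasure P (f -` A \<inter> I)" if "A \<subseteq> ?J" for A
    using emeasure_distr[OF meas] that P by simp
  have "emeasure ?Q {y} = 0" if y: "y \<in> ?J" for y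
  proof -
    obtain x where x: "x \<in> I" "f x = y" using bij_betw_imp_surj_on[OF f] y by (metis imageE)
    then have "f -` {y} \<inter> I = {x}" using bij_betw_imp_inj_on[OF f] by (fastforce dest: inj_onD)
    then show ?thesis using em[of "{y}"] y x P by simp
  qed
  moreover have "emeasure ?Q (\<Union>\<A>) = 0"
    if \<A>: "\<A> \<subseteq> Pow ?J" "|\<A>| <o \<nu>" "\<forall>A\<in>\<A>. emeasure ?Q A = 0" for \<A>
  proof -
    let ?B = "(\<lambda>A. f -` A \<inter> I) ` \<A>"
    have "|?B| <o \<kappa>"
      by (rule ordLess_ordIso_trans[OF ordLeq_ordLess_trans[OF card_of_image \<A>(2)]
            ordIso_symmetric[OF iso]])
    moreover have "\<forall>B\<in>?B. emeasure P B = 0"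
    proof
      fix B assume "B \<in> ?B"
      then obtain A where "A \<in> \<A>" "B = f -` A \<inter> I" by blast
      then show "emeasure P B = 0" using em[of A] \<A> by auto
    qed
    ultimately have "emeasure P (\<Union>?B) = 0" by (intro add) blast+
    moreover have "\<Union>?B = f -` (\<Union>\<A>) \<inter> I" by blast
    moreover have "\<Union>\<A> \<subseteq> ?J" using \<A>(1) by blast
    ultimately show ?thesis using em[of "\<Union>\<A>"] by simp
  qed
  moreover have "prob_space ?Q" by (rule prob_space.prob_space_distr[OF P(1) meas])
  moreover have "|?J| =o \<nu>" using co' by (rule card_of_Field_ordIso)
  moreover have "space ?Q = ?J" "sets ?Q = Pow ?J" by simp_all
  ultimately show ?thesis unfolding real_valued_measurable_def using co' by blast
qed

text \<open>
  To say that the density of a metric on \<open>'y\<close> lies strictly below every real-valued measurable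
  cardinal, it suffices to quantify over the cardinals on \<open>'y\<close>: a real-valued measurable cardinal
  on any other type is then strictly larger as well.
\<close>

lemma metric_density_less_all_types:
  fixes m :: "'y metric" and \<kappa> :: "'k rel"
  assumes less: "\<forall>\<nu>::'y rel. real_valued_measurable \<nu> \<longrightarrow> metric_density m <o \<nu>"
    and \<kappa>: "real_valued_measurable \<kappa>"
  shows "metric_density m <o \<kappa>"
proof (rule ccontr)
  assume neg: "\<not> metric_density m <o \<kappa>"
  obtain D where D: "metric_density m = |D|" using metric_density_attained by blast
  have co: "Card_order \<kappa>" using \<kappa> by (simp add: real_valued_measurable_def)
  then have le: "\<kappa> \<le>o |D|"
    using neg not_ordLess_iff_ordLeq[OF _ card_of_Well_order, of \<kappa> D]
    unfolding D card_order_on_def by blast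
  then have "|Field \<kappa>| \<le>o |D|"
    using co card_of_Field_ordIso ordIso_ordLeq_trans by blast
  then obtain J where J: "J \<subseteq> D" "|Field \<kappa>| =o |J|"
    using internalize_card_of_ordLeq2[of "Field \<kappa>" D] by blast
  then have iso: "\<kappa> =o |J|"
    using co card_of_Field_ordIso ordIso_symmetric ordIso_transitive by blast
  then have "metric_density m <o |J|" using less \<kappa> real_valued_measurable_transfer by blast
  moreover have "|J| \<le>o |D|" using J(1) by (rule card_of_mono1)
  ultimately show False using D not_ordLess_ordLeq by metis
qed

context real_normed_space_on
begin

lemma scale_zero_left: "x \<in> V \<Longrightarrow> scal 0 x = zero"
  using nrm_eq_zero nrm_scale scale_closed by fastforce

lemma scale_zero_right: "scal a zero = zero"
  by (metis nrm_eq_zero nrm_scale mult_zero_right scale_closed zero_closed)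

lemma add_minus: "x \<in> V \<Longrightarrow> add x (scal (- 1) x) = zero"
  by (metis add.right_inverse scale_add_left scale_one scale_zero_left)

lemma nrm_nonneg: "x \<in> V \<Longrightarrow> 0 \<le> nrm x"
  using nrm_triangle[of x "scal (- 1) x"] nrm_scale[of x "- 1"] add_minus[of x]
    nrm_eq_zero[OF zero_closed] scale_closed[of x "- 1"] by simp

lemma diff_split:
  assumes "x \<in> V" "y \<in> V" "z \<in> V"
  shows "add x (scal (- 1) z) = add (add x (scal (- 1) y)) (add y (scal (- 1) z))"
proof -
  have "add (scal (- 1) y) (add y (scal (- 1) z)) = scal (- 1) z"
    by (metis add_assoc add_commute add_minus add_zero assms(2,3) scale_closed zero_closed)
  then show ?thesis using add_assoc assms add_closed scale_closed by metis
qed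

lemma Metric_space_norm:
  "Metric_space V (\<lambda>x y. if x \<in> V \<and> y \<in> V then nrm (add x (scal (- 1) y)) else 0)"
proof
  show "0 \<le> (if x \<in> V \<and> y \<in> V then nrm (add x (scal (- 1) y)) else 0)" for x y
    by (simp add: add_closed nrm_nonneg scale_closed)
next
  fix x y
  have "scal (- 1) (add x (scal (- 1) y)) = add y (scal (- 1) x)" if "x \<in> V" "y \<in> V"
    using that by (simp add: scale_add_right scale_scale scale_closed scale_one add_commute)
  then show "(if x \<in> V \<and> y \<in> V then nrm (add x (scal (- 1) y)) else 0) =
      (if y \<in> V \<and> x \<in> V then nrm (add y (scal (- 1) x)) else 0)"
    using nrm_scale[of "add x (scal (- 1) y)" "- 1"] add_closed scale_closed by auto
next
  fix x y assume xy: "x \<in> V" "y \<in> V"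
  have "x = y" if "add x (scal (- 1) y) = zero"
    using diff_split[of x y zero] that xy
    by (metis add_commute add_zero scale_zero_right zero_closed)
  then show "((if x \<in> V \<and> y \<in> V then nrm (add x (scal (- 1) y)) else 0) = 0) = (x = y)"
    using xy add_minus[of x] nrm_eq_zero[of "add x (scal (- 1) y)"] add_closed[of x "scal (- 1) y"]
      scale_closed[of y "- 1"] by metis
next
  fix x y z assume "x \<in> V" "y \<in> V" "z \<in> V"
  then show "(if x \<in> V \<and> z \<in> V then nrm (add x (scal (- 1) z)) else 0)
      \<le> (if x \<in> V \<and> y \<in> V then nrm (add x (scal (- 1) y)) else 0) +
        (if y \<in> V \<and> z \<in> V then nrm (add y (scal (- 1) z)) else 0)"
    using diff_split[of x y z] nrm_triangle[of "add x (scal (- 1) y)" "add y (scal (- 1) z)"]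
      add_closed scale_closed by simp
qed

lemma mspace_norm_metric: "mspace (norm_metric V add scal nrm) = V"
  unfolding norm_metric_def by (rule Metric_space.mspace_metric[OF Metric_space_norm])

lemma mdist_norm_metric:
  "\<lbrakk>x \<in> V; y \<in> V\<rbrakk> \<Longrightarrow> mdist (norm_metric V add scal nrm) x y = nrm (add x (scal (- 1) y))"
  unfolding norm_metric_def by (simp add: Metric_space.mdist_metric[OF Metric_space_norm])

end

end

theory Submission
  imports Defs
begin

text \<open>
  Positive part. Let \<open>D\<close> be a dense set of least cardinality. For each radius \<open>q > 0\<close>, well-order \<open>D\<close>
  and send \<open>y\<close> to the least point of \<open>D\<close> at distance less than \<open>q\<close>. Every set of values, countable or
  not, has a Borel preimage under this selection \<open>h\<close>
  (lemma \<open>exists_measurable_approximate_selection\<close>): a preimage is a countable union of unions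
  of closed sets that lie at uniformly positive distance from each other. Hence \<open>h \<circ> G\<close> pushes \<open>\<mu>\<close>
  forward to a finite measure on all subsets of \<open>D\<close>. Such a measure must sit on its countably many
  point masses, for its remainder, if it were nonzero, would yield a real-valued measurable cardinal
  at most \<open>|D|\<close> (lemma \<open>real_valued_measurable_of_vanishing_on_points\<close>). So up to a set of
  arbitrarily small measure, \<open>h \<circ> G\<close> takes finitely many values. Truncating it for the radii
  \<open>1 / (n + 1)\<close>, with exceptional sets of measure below \<open>2\<^sup>-\<^sup>n\<close>, gives simple functions that converge
  to \<open>G\<close> almost everywhere by the Borel--Cantelli lemma.

  Negative part. Let \<open>P\<close> be a diffuse probability on all subsets of \<open>I\<close>, and let \<open>G\<close> map each
  point \<open>i\<close> to its indicator function in the space of bounded functions with the supremum norm.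
  Every map out of \<open>I\<close> is measurable. Distinct indicators have distance \<open>1\<close>, so a countable set can
  be within \<open>1/2\<close> of \<open>G i\<close> only for countably many \<open>i\<close>, that is, for a null set of \<open>i\<close>. This
  excludes both separability and almost everywhere approximation by simple functions.
\<close>

section \<open>Diffuse measures and real-valued measurable cardinals\<close>

text \<open>
  The cardinal obtained is the least size of a family of null sets whose union is not null. Sending
  a point of that union to the index of a member containing it, the normalised restriction of \<open>Q\<close>
  to the union is pushed forward to the index set; minimality gives the required additivity.
\<close>

lemma real_valued_measurable_of_vanishing_on_points:
  fixes Q :: "'a measure"
  assumes fin: "finite_measure Q" and sets: "sets Q = Pow A" and "N \<subseteq> A"
    and pts: "\<And>x. x \<in> N \<Longrightarrow> emeasure Q {x} = 0" and pos: "emeasure Q N \<noteq> 0"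
  shows "\<exists>\<kappa>::'a rel. real_valued_measurable \<kappa> \<and> \<kappa> \<le>o |N|"
proof -
  interpret finite_measure Q by fact
  have sp: "space Q = A" using sets sets.top[of Q] sets.sets_into_space[of A Q] by auto
  define nulls where "nulls J f \<longleftrightarrow> (\<forall>j\<in>J. f j \<subseteq> A \<and> emeasure Q (f j) = 0) \<and>
      emeasure Q (\<Union>j\<in>J. f j) \<noteq> 0" for J :: "'a set" and f :: "'a \<Rightarrow> 'a set"
  let ?R = "{ |J| | J f. nulls J f}"
  have "nulls N (\<lambda>x. {x})"
    using \<open>N \<subseteq> A\<close> pts pos unfolding nulls_def by auto
  then have N: "|N| \<in> ?R" by blast
  moreover have "\<forall>r\<in>?R. Card_order r" using card_of_Card_order by blast
  ultimately obtain r where "r \<in> ?R" "\<forall>r'\<in>?R. r \<le>o r'"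
    using exists_minim_Card_order[of ?R] by blast
  then obtain J f where J: "nulls J f" and min: "\<And>J' f'. nulls J' f' \<Longrightarrow> |J| \<le>o |J'|" by blast
  have small_null: "emeasure Q (\<Union>\<A>) = 0"
    if \<A>: "\<A> \<subseteq> Pow A" "|\<A>| <o |J|" "\<forall>B\<in>\<A>. emeasure Q B = 0" for \<A>
  proof (rule ccontr)
    assume nz: "emeasure Q (\<Union>\<A>) \<noteq> 0"
    obtain J' where J': "J' \<subseteq> J" "|\<A>| =o |J'|"
      using internalize_card_of_ordLeq2[of \<A> J] ordLess_imp_ordLeq[OF \<A>(2)] by blast
    obtain g where g: "bij_betw g J' \<A>"
      using J'(2) card_of_ordIso ordIso_symmetric by blast
    have im: "g ` J' = \<A>" using g by (rule bij_betw_imp_surj_on)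
    have "nulls J' g" unfolding nulls_def im using \<A> nz im by blast
    then have "|J| \<le>o |J'|" by (rule min)
    then have "|J| \<le>o |\<A>|" using J'(2) ordIso_symmetric ordLeq_ordIso_trans by blast
    then show False using \<A>(2) not_ordLess_ordLeq by blast
  qed
  define U where "U = (\<Union>j\<in>J. f j)"
  have fA: "f j \<subseteq> A" "emeasure Q (f j) = 0" if "j \<in> J" for j using J that unfolding nulls_def by auto
  have UA: "U \<subseteq> A" unfolding U_def using fA by auto
  have U0: "emeasure Q U \<noteq> 0" using J unfolding nulls_def U_def by simp
  then obtain j0 where j0: "j0 \<in> J" unfolding U_def by (metis SUP_empty emeasure_empty ex_in_conv)
  \<comment> \<open>Off \<open>U\<close> the value only has to lie in \<open>J\<close>, as the normalised measure ignores those points.\<close>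
  define h where "h x = (if x \<in> U then (SOME j. j \<in> J \<and> x \<in> f j) else j0)" for x
  have h: "h x \<in> J \<and> x \<in> f (h x)" if "x \<in> U" for x
  proof -
    have "\<exists>j. j \<in> J \<and> x \<in> f j" using that unfolding U_def by blast
    from someI_ex[OF this] show ?thesis using that unfolding h_def by simp
  qed
  have hJ: "h x \<in> J" for x using h j0 unfolding h_def by (cases "x \<in> U") auto
  let ?M = "uniform_measure Q U"
  let ?P = "distr ?M (count_space J) h"
  have prob: "prob_space ?M" using U0 by (intro prob_space_uniform_measure) simp_all
  have meas: "h \<in> ?M \<rightarrow>\<^sub>M count_space J"
    using hJ sets sp by (auto simp: measurable_def)
  have em: "emeasure ?P T = emeasure Q (U \<inter> h -` T) / emeasure Q U" if "T \<subseteq> J" for T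
  proof -
    have "U \<inter> (h -` T \<inter> A) = U \<inter> h -` T" using UA by auto
    then show ?thesis
      using emeasure_distr[OF meas, of T] that sets sp UA
        emeasure_uniform_measure[of U Q "h -` T \<inter> A"] by auto
  qed
  have em0: "emeasure ?P T = 0 \<longleftrightarrow> emeasure Q (U \<inter> h -` T) = 0" if "T \<subseteq> J" for T
    unfolding em[OF that] by simp
  have "real_valued_measurable |J|" unfolding real_valued_measurable_def
  proof (intro conjI exI[of _ J] exI[of _ ?P] ballI allI impI)
    show "prob_space ?P" by (rule prob_space.prob_space_distr[OF prob meas])
    show "emeasure ?P {x} = 0" if "x \<in> J" for x
    proof -
      have "U \<inter> h -` {x} \<subseteq> f x" using h by auto
      then have "emeasure Q (U \<inter> h -` {x}) \<le> emeasure Q (f x)"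
        using fA(1)[OF that] sets by (intro emeasure_mono) auto
      then show ?thesis using em0[of "{x}"] that fA(2)[OF that] by simp
    qed
    fix \<A> assume \<A>: "\<A> \<subseteq> Pow J \<and> |\<A>| <o |J| \<and> (\<forall>T\<in>\<A>. emeasure ?P T = 0)"
    let ?B = "(\<lambda>T. U \<inter> h -` T) ` \<A>"
    have "emeasure Q (\<Union>?B) = 0"
    proof (rule small_null)
      show "?B \<subseteq> Pow A" using UA by auto
      show "|?B| <o |J|" using \<A> card_of_image ordLeq_ordLess_trans by blast
      show "\<forall>B\<in>?B. emeasure Q B = 0" using \<A> em0 by auto
    qed
    moreover have "\<Union>?B = U \<inter> h -` (\<Union>\<A>)" by auto
    moreover have "\<Union>\<A> \<subseteq> J" using \<A> by blast
    ultimately show "emeasure ?P (\<Union>\<A>) = 0" using em0 by metis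
  qed (auto simp: card_of_Card_order card_of_refl)
  moreover have "|J| \<le>o |N|" using min \<open>nulls N (\<lambda>x. {x})\<close> by blast
  ultimately show ?thesis by blast
qed

text \<open>
  A finite measure defined on all subsets of a set that is smaller than every real-valued measurable
  cardinal lives on its atoms, so it is tight for the discrete topology.
\<close>

lemma finite_measure_tight_on_small_set:
  fixes Q :: "'a measure"
  assumes fin: "finite_measure Q" and sets: "sets Q = Pow D"
    and small: "\<And>\<kappa>::'a rel. real_valued_measurable \<kappa> \<Longrightarrow> |D| <o \<kappa>"
    and "\<epsilon> > 0"
  shows "\<exists>F. finite F \<and> F \<subseteq> D \<and> measure Q (D - F) < \<epsilon>"
proof -
  interpret finite_measure Q by fact
  define C where "C = D \<inter> {x. measure Q {x} \<noteq> 0}"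
  have C: "countable C" unfolding C_def using countable_support by blast
  have "emeasure Q (D - C) = 0"
  proof (rule ccontr)
    assume nz: "emeasure Q (D - C) \<noteq> 0"
    have "emeasure Q {x} = 0" if "x \<in> D - C" for x
      using that unfolding C_def by (simp add: emeasure_eq_measure)
    then obtain \<kappa> :: "'a rel" where \<kappa>: "real_valued_measurable \<kappa>" "\<kappa> \<le>o |D - C|"
      using real_valued_measurable_of_vanishing_on_points[OF fin sets, of "D - C"] nz by auto
    have "\<kappa> \<le>o |D|" using \<kappa>(2) card_of_mono1[of "D - C" D] ordLeq_transitive by blast
    then show False using small[OF \<kappa>(1)] not_ordLess_ordLeq by blast
  qed
  then have null: "measure Q (D - C) = 0" by (simp add: measure_def)
  \<comment> \<open>Finite sets exhausting the countable set \<open>C\<close> of point masses.\<close>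
  define F where "F n = {x \<in> C. to_nat_on C x < n}" for n
  have finF: "finite (F n)" for n
  proof (rule finite_imageD)
    show "finite (to_nat_on C ` F n)" by (rule finite_subset[of _ "{..<n}"]) (auto simp: F_def)
    show "inj_on (to_nat_on C) (F n)"
      by (rule inj_on_subset[OF inj_on_to_nat_on[OF C]]) (auto simp: F_def)
  qed
  have "(\<lambda>n. measure Q (D - F n)) \<longlonglongrightarrow> measure Q (\<Inter>n. D - F n)"
    by (rule finite_Lim_measure_decseq) (auto simp: sets F_def decseq_def)
  moreover have "(\<Inter>n. D - F n) = D - C" unfolding F_def by auto
  ultimately have "(\<lambda>n. measure Q (D - F n)) \<longlonglongrightarrow> 0" using null by simp
  then have "eventually (\<lambda>n. measure Q (D - F n) < \<epsilon>) sequentially"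
    using \<open>\<epsilon> > 0\<close> by (rule order_tendstoD(2))
  then obtain n where "measure Q (D - F n) < \<epsilon>" by (auto simp: eventually_sequentially)
  moreover have "F n \<subseteq> D" unfolding F_def C_def by auto
  ultimately show ?thesis using finF by blast
qed

section \<open>Borel sets of a metric space\<close>

lemma Pow_openin_mspace: "{U. openin (mtopology_of m) U} \<subseteq> Pow (mspace m)"
  using openin_subset[of "mtopology_of m"] by auto

lemma space_metric_borel: "space (metric_borel m) = mspace m"
  unfolding metric_borel_def by (rule space_measure_of[OF Pow_openin_mspace])

lemma sets_metric_borel_openin: "openin (mtopology_of m) U \<Longrightarrow> U \<in> sets (metric_borel m)"
  unfolding metric_borel_def by (subst sets_measure_of[OF Pow_openin_mspace]) auto

lemma sets_metric_borel_closedin: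
  assumes "closedin (mtopology_of m) C"
  shows "C \<in> sets (metric_borel m)"
proof -
  have "space (metric_borel m) - (mspace m - C) \<in> sets (metric_borel m)"
    using assms by (intro sets.compl_sets sets_metric_borel_openin) (simp add: closedin_def)
  moreover have "mspace m - (mspace m - C) = C"
    using closedin_subset[OF assms] by auto
  ultimately show ?thesis by (simp add: space_metric_borel)
qed

text \<open>
  Measurability refers to the full power set of \<open>D\<close>. For an index \<open>d\<close>, let \<open>F k d\<close> consist of the
  points at distance at most \<open>q - 1 / (k + 1)\<close> from \<open>d\<close> and at least \<open>q\<close> from all earlier points
  of \<open>D\<close>. For fixed \<open>k\<close> these sets are closed and have mutual distance at least \<open>1 / (k + 1)\<close>, so any
  union of them is closed; the union over \<open>k\<close> and \<open>d \<in> T\<close> is the preimage of \<open>T\<close>.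
\<close>

lemma exists_measurable_approximate_selection:
  fixes m :: "'y metric"
  assumes dense: "dense_subset m D" and "q > 0"
  shows "\<exists>h. h \<in> metric_borel m \<rightarrow>\<^sub>M count_space D \<and> (\<forall>y\<in>mspace m. mdist m y (h y) < q)"
proof -
  interpret Metric_space "mspace m" "mdist m" by simp
  have DM: "D \<subseteq> mspace m" using dense unfolding dense_subset_def by simp
  obtain r :: "'y rel" where wo: "Well_order r" and UN: "Field r = UNIV"
    by (metis well_ordering)
  have wf_r: "wf (r - Id)" using wo unfolding well_order_on_def by simp
  have "total_on UNIV r" using wo unfolding UN well_order_on_def linear_order_on_def by simp
  then have tot: "d = e \<or> (d, e) \<in> r - Id \<or> (e, d) \<in> r - Id" for d e
    unfolding total_on_def by blast
  define least where "least y d \<longleftrightarrow> d \<in> D \<and> mdist m y d < q \<and>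
      (\<forall>e\<in>D. (e, d) \<in> r - Id \<longrightarrow> q \<le> mdist m y e)" for y d
  have ex: "\<exists>d. least y d" if y: "y \<in> mspace m" for y
  proof -
    have "y \<in> mtopology closure_of D" using dense y unfolding dense_subset_def mtopology_of_def by simp
    then obtain d where "d \<in> D" "mdist m y d < q" using \<open>q > 0\<close> unfolding metric_closure_of by auto
    then have "d \<in> {d\<in>D. mdist m y d < q}" by simp
    from wfE_min[OF wf_r this] show ?thesis unfolding least_def by (metis (mono_tags, lifting) mem_Collect_eq not_less)
  qed
  have uniq: "d = e" if "least y d" "least y e" for y d e
    using tot[of d e] that unfolding least_def by force
  define h where "h y = (SOME d. least y d)" for y
  have h: "least y (h y)" if "y \<in> mspace m" for y
    unfolding h_def by (rule someI_ex[OF ex[OF that]])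
  have "h -` T \<inter> mspace m \<in> sets (metric_borel m)" if T: "T \<subseteq> D" for T
  proof -
    define F where "F k d = {y \<in> mspace m. mdist m y d \<le> q - inverse (real (Suc k)) \<and>
        (\<forall>e\<in>D. (e, d) \<in> r - Id \<longrightarrow> q \<le> mdist m y e)}" for k d
    have sep: "d = e"
      if yz: "y \<in> F k d" "z \<in> F k e" "d \<in> D" "e \<in> D" "mdist m y z < inverse (real (Suc k))" for k y z d e
    proof (rule ccontr)
      have *: "inverse (real (Suc k)) \<le> mdist m y z"
        if "y \<in> F k d" "z \<in> F k e" "d \<in> D" "(d, e) \<in> r - Id" for y z d e
      proof -
        have "mdist m z d \<le> mdist m z y + mdist m y d"
          using that DM by (intro triangle) (auto simp: F_def)
        moreover have "q \<le> mdist m z d" "mdist m y d \<le> q - inverse (real (Suc k))"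
          using that by (auto simp: F_def)
        ultimately show ?thesis by (simp add: commute)
      qed
      assume "d \<noteq> e"
      then show False using tot[of d e] *[of y d z e] *[of z e y d] yz by (auto simp: commute)
    qed
    have cl: "closedin mtopology (\<Union>d\<in>T. F k d)" (is "closedin _ ?S") for k
    proof -
      have "x \<in> ?S" if x: "x \<in> mtopology closure_of ?S" for x
      proof -
        have xM: "x \<in> mspace m" using x unfolding metric_closure_of by blast
        have near: "\<exists>d\<in>T. \<exists>y\<in>F k d. mdist m x y < s" if "s > 0" for s
          using x that unfolding metric_closure_of in_mball by blast
        let ?c = "inverse (real (Suc k)) / 2"
        have c: "?c > 0" by simp
        obtain d y where d: "d \<in> T" "y \<in> F k d" "mdist m x y < ?c" using near[OF c] by blast
        \<comment> \<open>By separation, all points of the union close to \<open>x\<close> come from the same index \<open>d\<close>.\<close>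
        have near': "\<exists>z\<in>F k d. mdist m x z < s" if "s > 0" for s
        proof -
          obtain e z where e: "e \<in> T" "z \<in> F k e" "mdist m x z < min s ?c"
            using near[of "min s ?c"] c \<open>s > 0\<close> by auto
          have "mdist m y z \<le> mdist m y x + mdist m x z"
            using d e xM by (intro triangle) (auto simp: F_def)
          then have "mdist m y z < inverse (real (Suc k))"
            using d(3) e(3) commute[of x y] by simp
          then have "d = e" using sep[OF d(2) e(2)] d(1) e(1) T by auto
          then show ?thesis using e by auto
        qed
        have "mdist m x d \<le> q - inverse (real (Suc k))"
        proof (rule field_le_epsilon)
          fix s :: real assume "s > 0"
          then obtain z where z: "z \<in> F k d" "mdist m x z < s" using near' by blast
          have "mdist m x d \<le> mdist m x z + mdist m z d"
            using z xM d(1) T DM by (intro triangle) (auto simp: F_def)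
          then show "mdist m x d \<le> q - inverse (real (Suc k)) + s" using z by (auto simp: F_def)
        qed
        moreover have "q \<le> mdist m x e" if e: "e \<in> D" "(e, d) \<in> r - Id" for e
        proof (rule field_le_epsilon)
          fix s :: real assume "s > 0"
          then obtain z where z: "z \<in> F k d" "mdist m x z < s" using near' by blast
          have "mdist m z e \<le> mdist m z x + mdist m x e"
            using z xM e(1) DM by (intro triangle) (auto simp: F_def)
          moreover have "q \<le> mdist m z e" using z(1) e by (auto simp: F_def)
          ultimately show "q \<le> mdist m x e + s" using z(2) commute[of x z] by simp
        qed
        ultimately have "x \<in> F k d" using xM unfolding F_def by blast
        then show ?thesis using d(1) by blast
      qed
      moreover have "?S \<subseteq> mspace m" unfolding F_def by auto
      ultimately show ?thesis using closure_of_subset_eq[of ?S mtopology] by auto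
    qed
    have "h -` T \<inter> mspace m = (\<Union>k. \<Union>d\<in>T. F k d)"
    proof (intro equalityI subsetI)
      fix y assume y: "y \<in> h -` T \<inter> mspace m"
      then have l: "least y (h y)" using h by blast
      then have "q - mdist m y (h y) > 0" unfolding least_def by simp
      then obtain k where "inverse (real (Suc k)) < q - mdist m y (h y)" using reals_Archimedean by blast
      then have "y \<in> F k (h y)" using l y unfolding F_def least_def by auto
      then show "y \<in> (\<Union>k. \<Union>d\<in>T. F k d)" using y by blast
    next
      fix y assume "y \<in> (\<Union>k. \<Union>d\<in>T. F k d)"
      then obtain k d where d: "d \<in> T" "y \<in> F k d" by blast
      have "mdist m y d \<le> q - inverse (real (Suc k))" using d(2) unfolding F_def by simp
      also have "\<dots> < q" by simp
      finally have "least y d" using d T unfolding F_def least_def by blast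
      moreover have yM: "y \<in> mspace m" using d(2) unfolding F_def by simp
      ultimately have "h y = d" using uniq h by blast
      then show "y \<in> h -` T \<inter> mspace m" using d(1) yM by simp
    qed
    also have "\<dots> \<in> sets (metric_borel m)"
      using cl sets_metric_borel_closedin[of m] by (intro sets.countable_UN) (auto simp: mtopology_of_def)
    finally show ?thesis .
  qed
  then have "h \<in> metric_borel m \<rightarrow>\<^sub>M count_space D"
    using h unfolding measurable_def space_metric_borel least_def by auto
  then show ?thesis using h unfolding least_def by blast
qed

section \<open>Strong measurability for small density\<close>

theorem strongly_measurable_of_small_density:
  fixes M :: "'x measure" and m :: "'y metric"
  assumes fin: "finite_measure M" and G: "G \<in> M \<rightarrow>\<^sub>M metric_borel m"
    and small: "\<And>\<kappa>::'y rel. real_valued_measurable \<kappa> \<Longrightarrow> metric_density m <o \<kappa>"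
  shows "strongly_measurable M m G"
proof -
  interpret M: finite_measure M by fact
  interpret Metric_space "mspace m" "mdist m" by simp
  have GM: "G x \<in> mspace m" if "x \<in> space M" for x
    using measurable_space[OF G that] by (simp add: space_metric_borel)
  obtain D where D: "dense_subset m D" "metric_density m = |D|"
    using metric_density_attained by blast
  have DM: "D \<subseteq> mspace m" using D(1) unfolding dense_subset_def by simp
  show ?thesis
  proof (cases "space M = {}")
    \<comment> \<open>Here \<open>D\<close> may be empty, so there need not be any value for the approximating functions.\<close>
    case True
    then have "simple_map M m G" using G unfolding simple_map_def by simp
    moreover have "AE x in M. limitin (mtopology_of m) (\<lambda>n::nat. G x) (G x) sequentially"
      using True by (intro AE_I2) simp
    ultimately show ?thesis
      using GM unfolding strongly_measurable_def by (intro conjI funcsetI exI[of _ "\<lambda>_. G"]) auto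
  next
    case False
    define q where "q n = inverse (real (Suc n))" for n
    have "\<forall>n. \<exists>h. h \<in> metric_borel m \<rightarrow>\<^sub>M count_space D \<and> (\<forall>y\<in>mspace m. mdist m y (h y) < q n)"
      using exists_measurable_approximate_selection[OF D(1)] unfolding q_def by simp
    then obtain h where h: "\<And>n. h n \<in> metric_borel m \<rightarrow>\<^sub>M count_space D"
      and near: "\<And>n y. y \<in> mspace m \<Longrightarrow> mdist m y (h n y) < q n" by metis
    define g where "g n x = h n (G x)" for n x
    have g: "g n \<in> M \<rightarrow>\<^sub>M count_space D" for n
      unfolding g_def by (rule measurable_compose[OF G h])
    have gD: "g n x \<in> D" if "x \<in> space M" for n x using measurable_space[OF g that] by simp
    have "\<exists>F. finite F \<and> F \<subseteq> D \<and> measure (distr M (count_space D) (g n)) (D - F) < (1/2)^n" for n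
      using small unfolding D(2)
      by (intro finite_measure_tight_on_small_set M.finite_measure_distr[OF g]) auto
    then obtain F where F: "\<And>n. finite (F n)" "\<And>n. F n \<subseteq> D"
      and tight: "\<And>n. measure (distr M (count_space D) (g n)) (D - F n) < (1/2)^n" by metis
    obtain x0 where x0: "x0 \<in> space M" using False by blast
    define d0 where "d0 = g 0 x0"
    have d0: "d0 \<in> D" unfolding d0_def by (rule gD[OF x0])
    \<comment> \<open>The value \<open>d0\<close> is an arbitrary default on the small exceptional set.\<close>
    define S where "S n x = (if g n x \<in> F n then g n x else d0)" for n x
    have simple: "simple_map M m (S n)" for n
    proof -
      have "(\<lambda>d. if d \<in> F n then d else d0) \<in> count_space D \<rightarrow>\<^sub>M metric_borel m"
        using d0 DM by (auto simp: space_metric_borel)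
      from measurable_compose[OF g this] have "S n \<in> M \<rightarrow>\<^sub>M metric_borel m"
        unfolding S_def .
      moreover have "finite (S n ` space M)"
        by (rule finite_subset[of _ "insert d0 (F n)"]) (use F in \<open>auto simp: S_def\<close>)
      ultimately show ?thesis unfolding simple_map_def by simp
    qed
    define B where "B n = g n -` (D - F n) \<inter> space M" for n
    have B: "B n \<in> sets M" for n
      unfolding B_def by (rule measurable_sets[OF g]) simp
    have mB: "measure M (B n) < (1/2)^n" for n
      using tight[of n] measure_distr[OF g, of "D - F n"] unfolding B_def by simp
    have "summable (\<lambda>n. measure M (B n))"
      by (rule summable_comparison_test[of _ "\<lambda>n. (1/2::real)^n"])
        (use mB in \<open>auto intro!: exI[of _ 0] less_imp_le summable_geometric\<close>)
    then have "AE x in M. eventually (\<lambda>n. x \<in> space M - B n) sequentially"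
      using B by (intro borel_cantelli_AE1) (simp_all add: M.emeasure_eq_measure)
    then have "AE x in M. limitin (mtopology_of m) (\<lambda>n. S n x) (G x) sequentially"
    proof (rule AE_mp, intro AE_I2 impI)
      fix x assume x: "x \<in> space M" and ev: "eventually (\<lambda>n. x \<in> space M - B n) sequentially"
      have "eventually (\<lambda>n. S n x \<in> mspace m \<and> mdist m (S n x) (G x) < \<epsilon>) sequentially" if "\<epsilon> > 0" for \<epsilon>
      proof -
        have "q \<longlonglongrightarrow> 0" unfolding q_def by (rule LIMSEQ_inverse_real_of_nat)
        then have "eventually (\<lambda>n. q n < \<epsilon>) sequentially" using \<open>\<epsilon> > 0\<close> by (rule order_tendstoD(2))
        with ev show ?thesis
        proof eventually_elim
          case (elim n)
          then have "S n x = g n x" using gD[OF x] x unfolding B_def S_def by auto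
          then show ?case
            using elim near[OF GM[OF x], of n] gD[OF x, of n] DM commute[of "G x"] unfolding g_def by auto
        qed
      qed
      then show "limitin (mtopology_of m) (\<lambda>n. S n x) (G x) sequentially"
        unfolding mtopology_of_def limitin_metric using GM[OF x] by blast
    qed
    then show ?thesis
      using simple GM unfolding strongly_measurable_def by (intro conjI funcsetI exI[of _ S]) auto
  qed
qed

section \<open>The Banach space of bounded functions\<close>

text \<open>
  The Banach space is \<open>\<ell>\<^sup>\<infinity>\<close> over the whole index type, with pointwise operations.
\<close>

definition bounded_functions :: "('i \<Rightarrow> real) set" where
  "bounded_functions = {f. bounded (range f)}"

text \<open>
  The supremum is that of \<^typ>\<open>real\<close>, which is only meaningful for bounded \<open>f\<close>.
\<close>

definition sup_norm :: "('i \<Rightarrow> real) \<Rightarrow> real" where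
  "sup_norm f = (SUP x. \<bar>f x\<bar>)"

text \<open>The metric of the supremum norm, with \<^const>\<open>bounded_functions\<close> as carrier.\<close>

abbreviation sup_metric :: "('i \<Rightarrow> real) metric" where
  "sup_metric \<equiv> norm_metric bounded_functions (\<lambda>f g x. f x + g x) (\<lambda>a f x. a * f x) sup_norm"

lemma bounded_functions_iff: "f \<in> bounded_functions \<longleftrightarrow> (\<exists>c. \<forall>x. \<bar>f x\<bar> \<le> c)"
  unfolding bounded_functions_def bounded_iff by auto

lemma bounded_functionsI: "(\<And>x. \<bar>f x\<bar> \<le> c) \<Longrightarrow> f \<in> bounded_functions"
  unfolding bounded_functions_iff by blast

lemma abs_le_sup_norm: "f \<in> bounded_functions \<Longrightarrow> \<bar>f x\<bar> \<le> sup_norm f"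
  unfolding sup_norm_def bounded_functions_iff by (intro cSUP_upper) (auto simp: bdd_above_def)

lemma sup_norm_le: "(\<And>x. \<bar>f x\<bar> \<le> c) \<Longrightarrow> sup_norm f \<le> c"
  unfolding sup_norm_def by (rule cSUP_least) auto

lemma bounded_functions_add:
  assumes "f \<in> bounded_functions" "g \<in> bounded_functions"
  shows "(\<lambda>x. f x + g x) \<in> bounded_functions"
  by (rule bounded_functionsI[of _ "sup_norm f + sup_norm g"])
    (metis abs_le_sup_norm[OF assms(1)] abs_le_sup_norm[OF assms(2)] abs_triangle_ineq add_mono order_trans)

lemma bounded_functions_scale:
  assumes "f \<in> bounded_functions"
  shows "(\<lambda>x. a * f x) \<in> bounded_functions"
  by (rule bounded_functionsI[of _ "\<bar>a\<bar> * sup_norm f"])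
    (simp add: abs_mult mult_left_mono abs_le_sup_norm[OF assms])

lemma sup_norm_scale:
  assumes f: "f \<in> bounded_functions"
  shows "sup_norm (\<lambda>x. a * f x) = \<bar>a\<bar> * sup_norm f"
proof (rule antisym)
  show le: "sup_norm (\<lambda>x. a * f x) \<le> \<bar>a\<bar> * sup_norm f"
    by (rule sup_norm_le) (simp add: abs_mult mult_left_mono abs_le_sup_norm[OF f])
  show "\<bar>a\<bar> * sup_norm f \<le> sup_norm (\<lambda>x. a * f x)"
  proof (cases "a = 0")
    case True
    then show ?thesis by (simp add: sup_norm_def)
  next
    case False
    have "sup_norm f \<le> sup_norm (\<lambda>x. a * f x) / \<bar>a\<bar>"
    proof (rule sup_norm_le)
      fix x
      show "\<bar>f x\<bar> \<le> sup_norm (\<lambda>x. a * f x) / \<bar>a\<bar>"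
        using abs_le_sup_norm[OF bounded_functions_scale[OF f, of a], of x] False
        by (simp add: abs_mult field_simps)
    qed
    then show ?thesis using False by (simp add: field_simps)
  qed
qed

lemma sup_norm_eq_zero:
  assumes f: "f \<in> bounded_functions"
  shows "sup_norm f = 0 \<longleftrightarrow> f = (\<lambda>x. 0)"
proof
  assume "sup_norm f = 0"
  then show "f = (\<lambda>x. 0)" using abs_le_sup_norm[OF f] by (intro ext) simp
qed (simp add: sup_norm_def)

lemma sup_norm_triangle:
  assumes "f \<in> bounded_functions" "g \<in> bounded_functions"
  shows "sup_norm (\<lambda>x. f x + g x) \<le> sup_norm f + sup_norm g"
  by (rule sup_norm_le)
    (metis abs_le_sup_norm[OF assms(1)] abs_le_sup_norm[OF assms(2)] abs_triangle_ineq add_mono order_trans)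

interpretation bf: real_normed_space_on bounded_functions "\<lambda>f g x. f x + g x" "\<lambda>x. 0"
    "\<lambda>a f x. a * f x" sup_norm
proof
  fix f :: "'a \<Rightarrow> real" assume f: "f \<in> bounded_functions"
  show "\<exists>g\<in>bounded_functions. (\<lambda>x. f x + g x) = (\<lambda>x. 0)"
    using bounded_functions_scale[OF f, of "- 1"] by (intro bexI) auto
qed (auto simp: algebra_simps bounded_functions_add bounded_functions_scale sup_norm_scale
    sup_norm_eq_zero sup_norm_triangle intro: bounded_functionsI[of _ 0])

lemma mspace_sup_metric: "mspace sup_metric = bounded_functions"
  by (rule bf.mspace_norm_metric)

lemma mdist_sup_metric:
  "\<lbrakk>f \<in> bounded_functions; g \<in> bounded_functions\<rbrakk> \<Longrightarrow> mdist sup_metric f g = sup_norm (\<lambda>x. f x - g x)"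
  by (simp add: bf.mdist_norm_metric)

lemma abs_diff_le_mdist_sup_metric:
  assumes "f \<in> bounded_functions" "g \<in> bounded_functions"
  shows "\<bar>f x - g x\<bar> \<le> mdist sup_metric f g"
  using abs_le_sup_norm[of "\<lambda>x. f x - g x" x] assms
    bounded_functions_add[of f "\<lambda>x. - 1 * g x"] bounded_functions_scale[of g "- 1"]
  by (simp add: mdist_sup_metric)

text \<open>Completeness is the uniform Cauchy criterion.\<close>

lemma mcomplete_sup_metric: "mcomplete_of (sup_metric :: ('i \<Rightarrow> real) metric)"
proof -
  interpret Metric_space "mspace (sup_metric :: ('i \<Rightarrow> real) metric)" "mdist sup_metric" by simp
  have mcomplete unfolding mcomplete_def
  proof (intro allI impI)
    fix \<sigma> :: "nat \<Rightarrow> 'i \<Rightarrow> real" assume \<sigma>: "MCauchy \<sigma>"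
    have bd: "\<sigma> n \<in> bounded_functions" for n
    proof -
      have "range \<sigma> \<subseteq> mspace sup_metric" using \<sigma> unfolding MCauchy_def by blast
      then show ?thesis unfolding mspace_sup_metric by blast
    qed
    have "\<exists>N. \<forall>j k x. N \<le> j \<and> N \<le> k \<and> True \<longrightarrow> dist (\<sigma> j x) (\<sigma> k x) < e" if "e > 0" for e
    proof -
      obtain N where "\<And>j k. \<lbrakk>N \<le> j; N \<le> k\<rbrakk> \<Longrightarrow> mdist sup_metric (\<sigma> j) (\<sigma> k) < e"
        using \<sigma> \<open>e > 0\<close> unfolding MCauchy_def by blast
      then show ?thesis
        using abs_diff_le_mdist_sup_metric[OF bd bd] unfolding dist_real_def
        by (meson le_less_trans)
    qed
    then have "\<exists>l. \<forall>e>0. \<exists>N. \<forall>n x. N \<le> n \<and> True \<longrightarrow> dist (\<sigma> n x) (l x) < e"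
      using uniformly_convergent_eq_cauchy[of "\<lambda>_. True" \<sigma>] by blast
    then obtain l where l: "\<And>e. e > 0 \<Longrightarrow> \<exists>N. \<forall>n x. N \<le> n \<longrightarrow> \<bar>\<sigma> n x - l x\<bar> < e"
      unfolding dist_real_def by auto
    have lbd: "l \<in> bounded_functions"
    proof -
      obtain N where N: "\<And>x. \<bar>\<sigma> N x - l x\<bar> < 1" using l[of 1] by auto
      show ?thesis
      proof (rule bounded_functionsI)
        fix x
        show "\<bar>l x\<bar> \<le> sup_norm (\<sigma> N) + 1"
          using N[of x] abs_le_sup_norm[OF bd, of N x] by linarith
      qed
    qed
    have "eventually (\<lambda>n. \<sigma> n \<in> mspace sup_metric \<and> mdist sup_metric (\<sigma> n) l < e) sequentially"
      if "e > 0" for e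
    proof -
      obtain N where N: "\<forall>n x. N \<le> n \<longrightarrow> \<bar>\<sigma> n x - l x\<bar> < e / 2" using l[of "e / 2"] \<open>e > 0\<close> by auto
      have "mdist sup_metric (\<sigma> n) l < e" if "N \<le> n" for n
      proof -
        have "sup_norm (\<lambda>x. \<sigma> n x - l x) \<le> e / 2"
          using N that by (intro sup_norm_le) (auto intro: less_imp_le)
        then show ?thesis using \<open>e > 0\<close> by (simp add: mdist_sup_metric bd lbd)
      qed
      then show ?thesis unfolding eventually_sequentially mspace_sup_metric using bd by blast
    qed
    then have "limitin mtopology \<sigma> l sequentially"
      unfolding limitin_metric using lbd mspace_sup_metric by blast
    then show "\<exists>l. limitin mtopology \<sigma> l sequentially" by blast
  qed
  then show ?thesis unfolding mcomplete_of_def .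
qed

lemma real_banach_space_on_bounded_functions:
  "real_banach_space_on (bounded_functions :: ('i \<Rightarrow> real) set) (\<lambda>f g x. f x + g x) (\<lambda>x. 0)
    (\<lambda>a f x. a * f x) sup_norm"
  using bf.real_normed_space_on_axioms mcomplete_sup_metric
  unfolding real_banach_space_on_def real_banach_space_on_axioms_def by (rule conjI)

section \<open>A measurable function that is not strongly measurable\<close>

text \<open>The indicator function of the point \<open>i\<close>; distinct points have indicators at distance \<open>1\<close>.\<close>

definition point_indicator :: "'i \<Rightarrow> 'i \<Rightarrow> real" where
  "point_indicator i = indicator {i}"

lemma point_indicator_bounded: "point_indicator i \<in> bounded_functions"
  by (rule bounded_functionsI[of _ 1]) (simp add: point_indicator_def indicator_def)

text \<open>
  An element within \<open>1/2\<close> of the indicator of \<open>i\<close> has value above \<open>1/2\<close> at \<open>i\<close>, and one within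
  \<open>1/2\<close> of the indicator of another point has value below \<open>1/2\<close> at \<open>i\<close>. So it determines \<open>i\<close>.
\<close>

lemma countable_of_point_indicators_near_countable:
  assumes C: "countable C" "C \<subseteq> bounded_functions"
    and near: "\<And>i. i \<in> A \<Longrightarrow> \<exists>c\<in>C. mdist sup_metric (point_indicator i) c < 1/2"
  shows "countable A"
proof -
  obtain c where c: "\<And>i. i \<in> A \<Longrightarrow> c i \<in> C"
    "\<And>i. i \<in> A \<Longrightarrow> mdist sup_metric (point_indicator i) (c i) < 1/2"
    using near by metis
  have coord: "\<bar>point_indicator i x - c i x\<bar> < 1/2" if "i \<in> A" for i x
    using abs_diff_le_mdist_sup_metric[OF point_indicator_bounded, of "c i" i x] c[OF that] C(2)
    by fastforce
  have "inj_on c A"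
  proof (rule inj_onI, rule ccontr)
    fix i j assume ij: "i \<in> A" "j \<in> A" "c i = c j" "i \<noteq> j"
    then show False using coord[of i i] coord[of j i] by (simp add: point_indicator_def)
  qed
  moreover have "countable (c ` A)" using c(1) C(1) by (meson countable_subset image_subsetI)
  ultimately show ?thesis by (rule countable_image_inj_on[rotated])
qed

theorem point_indicator_counterexample:
  fixes P :: "'i measure"
  assumes prob: "prob_space P" and sets: "sets P = Pow I"
    and pts: "\<And>x. x \<in> I \<Longrightarrow> emeasure P {x} = 0"
  shows "\<not> separable_space (mtopology_of (sup_metric :: ('i \<Rightarrow> real) metric))"
    and "point_indicator \<in> P \<rightarrow>\<^sub>M metric_borel sup_metric"
    and "\<not> strongly_measurable P sup_metric point_indicator"
proof -
  interpret prob_space P by fact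
  interpret Metric_space "mspace (sup_metric :: ('i \<Rightarrow> real) metric)" "mdist sup_metric" by simp
  have sp: "space P = I"
    using sets sets.top[of P] sets.sets_into_space[of I P] by auto
  have null: "emeasure P A = 0" if "countable A" "A \<subseteq> I" for A

  proof -
    have "(\<Union>x\<in>A. {x}) \<in> null_sets P"
      using that pts sets by (intro null_sets_UN') (auto simp: null_sets_def)
    then show ?thesis by auto
  qed
  show "\<not> separable_space (mtopology_of (sup_metric :: ('i \<Rightarrow> real) metric))"
  proof
    assume "separable_space (mtopology_of (sup_metric :: ('i \<Rightarrow> real) metric))"
    then obtain C where C: "countable C" "C \<subseteq> bounded_functions"
      "mtopology closure_of C = (bounded_functions :: ('i \<Rightarrow> real) set)"
      unfolding separable_space_def topspace_mtopology_of mspace_sup_metric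
      by (auto simp: mtopology_of_def mspace_sup_metric)
    have "\<exists>c\<in>C. mdist sup_metric (point_indicator i) c < 1/2" for i
    proof -
      have "point_indicator i \<in> mtopology closure_of C" unfolding C(3) by (rule point_indicator_bounded)
      moreover have "(1/2 :: real) > 0" by simp
      ultimately show ?thesis unfolding metric_closure_of in_mball by blast
    qed
    then have "countable I" using countable_of_point_indicators_near_countable[OF C(1,2)] by blast
    then show False using null[of I] emeasure_space_1 sp by simp
  qed
  show "point_indicator \<in> P \<rightarrow>\<^sub>M metric_borel sup_metric"
    using point_indicator_bounded sets sp
    by (auto simp: measurable_def space_metric_borel mspace_sup_metric)
  show "\<not> strongly_measurable P sup_metric point_indicator"
  proof
    assume "strongly_measurable P sup_metric point_indicator"
    then obtain S where S: "\<And>n. simple_map P sup_metric (S n)"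
      and lim: "AE x in P. limitin (mtopology_of sup_metric) (\<lambda>n. S n x) (point_indicator x) sequentially"
      unfolding strongly_measurable_def by blast
    from lim obtain N where N: "N \<in> null_sets P"
      and good: "\<And>x. x \<in> I - N \<Longrightarrow> limitin mtopology (\<lambda>n. S n x) (point_indicator x) sequentially"
      unfolding mtopology_of_def sp[symmetric] by (rule AE_E3) blast
    let ?C = "\<Union>n. S n ` I"
    have "countable ?C" using S unfolding simple_map_def sp by (auto intro: countable_finite)
    moreover have "?C \<subseteq> bounded_functions"
    proof -
      have "S n x \<in> bounded_functions" if "x \<in> I" for n x
        using S[of n] that measurable_space[of "S n" P "metric_borel sup_metric" x]
        unfolding simple_map_def space_metric_borel mspace_sup_metric sp by blast
      then show ?thesis by blast
    qed
    moreover have "\<exists>c\<in>?C. mdist sup_metric (point_indicator i) c < 1/2" if i: "i \<in> I - N" for i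
    proof -
      have "\<forall>e>0. eventually (\<lambda>n. S n i \<in> mspace sup_metric \<and>
          mdist sup_metric (S n i) (point_indicator i) < e) sequentially"
        using good[OF i] unfolding limitin_metric by blast
      from this[rule_format, OF half_gt_zero[OF zero_less_one]]
      obtain n where "mdist sup_metric (S n i) (point_indicator i) < 1/2"
        unfolding eventually_sequentially by blast
      then show ?thesis using i by (intro bexI[of _ "S n i"]) (auto simp: commute)
    qed
    ultimately have "countable (I - N)" by (rule countable_of_point_indicators_near_countable)
    then have "emeasure P (I - N) = 0" by (rule null) simp
    moreover have "emeasure P (I - N) = emeasure P I"
      using N sp sets.top[of P] by (intro emeasure_Diff_null_set) auto
    ultimately show False using emeasure_space_1 sp by simp
  qed
qed

section \<open>Strong measurability and real-valued measurable cardinals\<close>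

theorem theorem3p6:
  shows
    "(\<forall>(M::'x measure) (m::'y metric) (G::'x \<Rightarrow> 'y).
        finite_measure M \<and> G \<in> M \<rightarrow>\<^sub>M metric_borel m \<and>
        (\<forall>\<kappa>::'y rel. real_valued_measurable \<kappa> \<longrightarrow> metric_density m <o \<kappa>)
        \<longrightarrow> strongly_measurable M m G)
     \<and>
     ((\<exists>\<kappa>::'i rel. real_valued_measurable \<kappa>) \<longrightarrow>
        (\<exists>(M::'i measure) (V::('i \<Rightarrow> real) set) add zero scal nrm (G::'i \<Rightarrow> 'i \<Rightarrow> real).
           finite_measure M \<and>
           real_banach_space_on V add zero scal nrm \<and>
           \<not> separable_space (mtopology_of (norm_metric V add scal nrm)) \<and>
           G \<in> M \<rightarrow>\<^sub>M metric_borel (norm_metric V add scal nrm) \<and>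
           \<not> strongly_measurable M (norm_metric V add scal nrm) G))"
proof (intro conjI allI impI)
  fix M :: "'x measure" and m :: "'y metric" and G :: "'x \<Rightarrow> 'y"
  assume "finite_measure M \<and> G \<in> M \<rightarrow>\<^sub>M metric_borel m \<and>
    (\<forall>\<kappa>::'y rel. real_valued_measurable \<kappa> \<longrightarrow> metric_density m <o \<kappa>)"
  then show "strongly_measurable M m G" by (intro strongly_measurable_of_small_density) auto
next
  assume "\<exists>\<kappa>::'i rel. real_valued_measurable \<kappa>"
  then obtain I and P :: "'i measure" where P: "prob_space P" "sets P = Pow I"
      "\<And>x. x \<in> I \<Longrightarrow> emeasure P {x} = 0"
    unfolding real_valued_measurable_def by auto
  have "finite_measure P" using P(1) by (rule prob_space.finite_measure)
  then show "\<exists>(M::'i measure) (V::('i \<Rightarrow> real) set) add zero scal nrm (G::'i \<Rightarrow> 'i \<Rightarrow> real).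
      finite_measure M \<and>
      real_banach_space_on V add zero scal nrm \<and>
      \<not> separable_space (mtopology_of (norm_metric V add scal nrm)) \<and>
      G \<in> M \<rightarrow>\<^sub>M metric_borel (norm_metric V add scal nrm) \<and>
      \<not> strongly_measurable M (norm_metric V add scal nrm) G"
    using real_banach_space_on_bounded_functions point_indicator_counterexample[OF P]
    by (intro exI conjI)
qed

end
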